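(* Let $H:\mathbb{T}^d\to\mathbb{R}^d$ be a $C^1$ vector field that is $\mathbb{T}^m$-equivariant, i.e. $H(\theta+R\phi)=H(\theta)$ for all $\theta\in\mathbb{T}^d$, $\phi\in\mathbb{T}^m$. Let $\theta_0\in\mathbb{T}^d$ and $\Omega\in\mathbb{R}^m$ satisfy $H(\theta_0)=R\Omega$, and let $E(\phi)=\theta_0+R\phi$ be the embedding of the corresponding relative equilibrium, assumed to be normally hyperbolic. Let $N:\mathbb{R}^{d-m}\to\mathbb{R}^d$ be an injective linear map and $L:\mathbb{R}^{d-m}\to\mathbb{R}^{d-m}$ a hyperbolic linear map with $\mathbb{R}^d=\operatorname{im}R\oplus\operatorname{im}N$ and $DH(E(\phi))N=NL$ for all $\phi\in\mathbb{T}^m$. Let $Z:\mathbb{T}^d\to\mathbb{R}^d$ and $G_1:=Z\circ E:\mathbb{T}^m\to\mathbb{R}^d$. Let $X_1:\mathbb{T}^m\to\mathbb{R}^m$ and $Y_1:\mathbb{T}^m\to\mathbb{R}^{d-m}$ be $C^1$ maps, let $f_1:\mathbb{T}^m\to\mathbb{R}^m$, and put $e_1(\phi)=RX_1(\phi)+NY_1(\phi)$. Then the infinitesimal conjugacy equation $$(\partial_\Omega-DH\circ E)\,e_1+R f_1=G_1$$ holds on $\mathbb{T}^m$ if and only if $$R(\partial_\Omega X_1+f_1)+N(\partial_\Omega-L)(Y_1)=G_1$$ holds on $\mathbb{T}^m$.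
   Context: $\mathbb{T}=\mathbb{R}/2\pi\mathbb{Z}$. $R:\mathbb{R}^m\to\mathbb{R}^d$ is a linear map whose matrix has integer coefficients, so that it also induces a map $\mathbb{T}^m\to\mathbb{T}^d$ (again denoted $R$). The group $\mathbb{T}^m$ acts on $\mathbb{T}^d$ by $\theta\mapsto\theta+R\phi$, and this action is assumed to be free (so $R$ is injective). For a $C^1$ map $e$ on $\mathbb{T}^m$, $\partial_\Omega e$ denotes the derivative in the direction $\Omega$: $(\partial_\Omega e)(\phi):=De(\phi)\Omega$. A linear map is hyperbolic if none of its eigenvalues lies on the imaginary axis. Normal hyperbolicity of the invariant torus $E(\mathbb{T}^m)$ is meant in the standard sense for the flow of $H$. The infinitesimal conjugacy equation is the $\mathcal{O}(\delta)$ part of the conjugacy equation $De(\phi)f(\phi)=F(e(\phi))$ with $F=H+\delta Z$, $e=E+\delta e_1+\mathcal{O}(\delta^2)$, $f=\Omega+\delta f_1+\mathcal{O}(\delta^2)$. *)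

theory Defs
  imports "HOL-Analysis.Analysis"
begin

section \<open>The torus\<close>

definition circle_rel :: "real \<Rightarrow> real \<Rightarrow> bool" where
  "circle_rel x y \<longleftrightarrow> (\<exists>k::int. x - y = 2 * pi * of_int k)"

lemma equivp_circle_rel: "equivp circle_rel"
proof (rule equivpI)
  show "reflp circle_rel"
    by (rule reflpI) (auto simp: circle_rel_def intro: exI[of _ 0])
  show "symp circle_rel"
  proof (rule sympI)
    fix x y assume "circle_rel x y"
    then obtain k :: int where "x - y = 2 * pi * of_int k" by (auto simp: circle_rel_def)
    then have "y - x = 2 * pi * of_int (- k)" by simp
    then show "circle_rel y x" unfolding circle_rel_def by blast
  qed
  show "transp circle_rel"
  proof (rule transpI)
    fix x y z assume "circle_rel x y" "circle_rel y z"
    then obtain k l :: int where "x - y = 2 * pi * of_int k" "y - z = 2 * pi * of_int l"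
      by (auto simp: circle_rel_def)
    then have "x - z = 2 * pi * of_int (k + l)" by (simp add: algebra_simps)
    then show "circle_rel x z" unfolding circle_rel_def by blast
  qed
qed

text \<open>The group \<open>\<real>/2\<pi>\<int>\<close>. The torus \<open>\<T>\<^sup>n\<close> is \<open>circle ^ 'n\<close>, with the componentwise
  group structure of the library.\<close>

quotient_type circle = real / circle_rel
  by (rule equivp_circle_rel)

instantiation circle :: ab_group_add
begin

lift_definition zero_circle :: circle is "0 :: real" .

lift_definition plus_circle :: "circle \<Rightarrow> circle \<Rightarrow> circle" is "(+)"
proof -
  fix x y u v assume "circle_rel x y" "circle_rel u v"
  then obtain k l :: int where "x - y = 2 * pi * of_int k" "u - v = 2 * pi * of_int l"
    by (auto simp: circle_rel_def)
  then have "(x + u) - (y + v) = 2 * pi * of_int (k + l)" by (simp add: algebra_simps)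
  then show "circle_rel (x + u) (y + v)" unfolding circle_rel_def by blast
qed

lift_definition uminus_circle :: "circle \<Rightarrow> circle" is uminus
proof -
  fix x y assume "circle_rel x y"
  then obtain k :: int where "x - y = 2 * pi * of_int k" by (auto simp: circle_rel_def)
  then have "- x - - y = 2 * pi * of_int (- k)" by simp
  then show "circle_rel (- x) (- y)" unfolding circle_rel_def by blast
qed

definition minus_circle :: "circle \<Rightarrow> circle \<Rightarrow> circle" where
  "minus_circle p q = p + - q"

instance
proof
  fix p q r :: circle
  show "p + q + r = p + (q + r)" by transfer (simp add: circle_rel_def add.assoc)
  show "p + q = q + p" by transfer (simp add: circle_rel_def add.commute)
  show "0 + p = p" by transfer (simp add: circle_rel_def)
  show "- p + p = 0" by transfer (simp add: circle_rel_def)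
  show "p - q = p + - q" by (simp add: minus_circle_def)
qed

end

definition torus_proj :: "real ^ 'n \<Rightarrow> circle ^ 'n" where
  "torus_proj x = (\<chi> i. abs_circle (x $ i))"

definition torus_rep :: "circle ^ 'n \<Rightarrow> real ^ 'n" where
  "torus_rep p = (\<chi> i. rep_circle (p $ i))"

lemma torus_proj_rep [simp]: "torus_proj (torus_rep p) = p"
  by (simp add: torus_proj_def torus_rep_def vec_eq_iff Quotient_abs_rep[OF Quotient_circle])

lemma torus_proj_add: "torus_proj (x + y) = torus_proj x + torus_proj y"
  by (simp add: torus_proj_def vec_eq_iff plus_circle.abs_eq)

lemma torus_proj_eq_iff:
  "torus_proj x = torus_proj y \<longleftrightarrow> (\<forall>i. \<exists>k::int. x $ i - y $ i = 2 * pi * of_int k)"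
  by (simp add: torus_proj_def vec_eq_iff circle.abs_eq_iff circle_rel_def)

text \<open>The map of tori induced by a linear map with integer matrix; \<open>torus_map_proj\<close> shows that
  it does not depend on the representative.\<close>

definition torus_map :: "(real ^ 'm \<Rightarrow> real ^ 'd) \<Rightarrow> circle ^ 'm \<Rightarrow> circle ^ 'd" where
  "torus_map R p = torus_proj (R (torus_rep p))"

lemma torus_map_proj:
  fixes R :: "real ^ 'm \<Rightarrow> real ^ 'd"
  assumes "linear R" and int: "\<And>i j. matrix R $ i $ j \<in> \<int>"
  shows "torus_map R (torus_proj x) = torus_proj (R x)"
proof -
  let ?y = "torus_rep (torus_proj x)"
  have "torus_proj ?y = torus_proj x" by simp
  then have "\<exists>k :: 'm \<Rightarrow> int. \<forall>i. ?y $ i - x $ i = 2 * pi * of_int (k i)"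
    unfolding torus_proj_eq_iff by (rule choice)
  then obtain k :: "'m \<Rightarrow> int" where k: "\<And>i. ?y $ i - x $ i = 2 * pi * of_int (k i)"
    by blast
  define a where "a i j = \<lfloor>matrix R $ i $ j\<rfloor>" for i j
  have a: "matrix R $ i $ j = of_int (a i j)" for i j
    using int[of i j] by (simp add: a_def)
  have "R ?y $ i - R x $ i = 2 * pi * of_int (\<Sum>j\<in>UNIV. a i j * k j)" for i
  proof -
    have "R ?y - R x = matrix R *v (?y - x)"
      using assms(1) by (simp add: linear_diff matrix_works)
    then have "R ?y $ i - R x $ i = (matrix R *v (?y - x)) $ i"
      by (simp flip: vector_minus_component)
    then show ?thesis
      by (simp add: matrix_vector_mult_def k a sum_distrib_left mult.left_commute)
  qed
  then show ?thesis
    unfolding torus_map_def torus_proj_eq_iff by blast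
qed

section \<open>Calculus on the torus\<close>

definition C1_on_torus :: "(circle ^ 'n \<Rightarrow> real ^ 'k) \<Rightarrow> bool" where
  "C1_on_torus f \<longleftrightarrow>
     (\<exists>f' :: real ^ 'n \<Rightarrow> (real ^ 'n) \<Rightarrow>\<^sub>L (real ^ 'k).
        (\<forall>x. ((f \<circ> torus_proj) has_derivative blinfun_apply (f' x)) (at x)) \<and>
        continuous_on UNIV f')"

text \<open>The derivative \<open>Df(p)v\<close>, computed on the universal cover; by \<open>torus_deriv_proj\<close> it does
  not depend on the representative.\<close>

definition torus_deriv ::
    "(circle ^ 'n \<Rightarrow> real ^ 'k) \<Rightarrow> circle ^ 'n \<Rightarrow> real ^ 'n \<Rightarrow> real ^ 'k" where
  "torus_deriv f p = frechet_derivative (f \<circ> torus_proj) (at (torus_rep p))"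

lemma torus_deriv_proj:
  fixes f :: "circle ^ 'n \<Rightarrow> real ^ 'k"
  assumes "((f \<circ> torus_proj) has_derivative D) (at x)"
  shows "torus_deriv f (torus_proj x) = D"
proof -
  let ?y = "torus_rep (torus_proj x)"
  have "torus_proj (z + (x - ?y)) = torus_proj z" for z
  proof -
    have "torus_proj x = torus_proj ?y" by simp
    then show ?thesis unfolding torus_proj_eq_iff by simp
  qed
  then have shift: "(f \<circ> torus_proj) \<circ> (\<lambda>z. z + (x - ?y)) = f \<circ> torus_proj"
    by auto
  have "((\<lambda>z. z + (x - ?y)) has_derivative (\<lambda>h. h)) (at ?y)"
    by (auto intro!: derivative_eq_intros)
  moreover have "((f \<circ> torus_proj) has_derivative D) (at (?y + (x - ?y)))"
    using assms by simp
  ultimately have "(((f \<circ> torus_proj) \<circ> (\<lambda>z. z + (x - ?y))) has_derivative D \<circ> (\<lambda>h. h)) (at ?y)"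
    by (rule diff_chain_at)
  then have "((f \<circ> torus_proj) has_derivative D) (at ?y)"
    unfolding shift by (simp add: o_def)
  then show ?thesis
    unfolding torus_deriv_def by (rule frechet_derivative_at[symmetric])
qed

definition dir_deriv :: "real ^ 'm \<Rightarrow> (circle ^ 'm \<Rightarrow> real ^ 'k) \<Rightarrow> circle ^ 'm \<Rightarrow> real ^ 'k" where
  "dir_deriv \<Omega> e \<phi> = torus_deriv e \<phi> \<Omega>"

section \<open>Hyperbolicity\<close>

definition hyperbolic :: "(real ^ 'k \<Rightarrow> real ^ 'k) \<Rightarrow> bool" where
  "hyperbolic L \<longleftrightarrow>
     (\<forall>(z::complex) (w::complex ^ 'k).
        w \<noteq> 0 \<and> (\<chi> i j. complex_of_real (matrix L $ i $ j)) *v w = z *s w \<longrightarrow> Re z \<noteq> 0)"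

text \<open>The flow of a \<open>C\<^sup>1\<close> vector field on the torus, lifted to the universal cover. The torus is
  compact, so solutions exist for all time, and they are unique.\<close>

definition flow_lift :: "(circle ^ 'd \<Rightarrow> real ^ 'd) \<Rightarrow> real \<Rightarrow> real ^ 'd \<Rightarrow> real ^ 'd" where
  "flow_lift H t x =
     (THE \<gamma>. \<gamma> 0 = x \<and> (\<forall>s. (\<gamma> has_vector_derivative H (torus_proj (\<gamma> s))) (at s))) t"

definition flow_deriv ::
    "(circle ^ 'd \<Rightarrow> real ^ 'd) \<Rightarrow> real \<Rightarrow> real ^ 'd \<Rightarrow> real ^ 'd \<Rightarrow> real ^ 'd" where
  "flow_deriv H t x = frechet_derivative (flow_lift H t) (at x)"

text \<open>Velocities of curves in \<open>M\<close> through \<open>p\<close>, in the global trivialisation of the tangent bundle.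
  The curve is only required to be differentiable at time \<open>0\<close>, so asking that it stay in \<open>M\<close> for
  all times is no restriction.\<close>

definition tangent_space :: "(circle ^ 'd) set \<Rightarrow> circle ^ 'd \<Rightarrow> (real ^ 'd) set" where
  "tangent_space M p =
     {v. \<exists>\<gamma>. torus_proj (\<gamma> 0) = p \<and> (\<forall>t. torus_proj (\<gamma> t) \<in> M) \<and>
             (\<gamma> has_vector_derivative v) (at 0)}"

text \<open>A continuous subbundle over \<open>M\<close>: the image of a continuous family of projections.\<close>

definition continuous_subbundle ::
    "(circle ^ 'd) set \<Rightarrow> (circle ^ 'd \<Rightarrow> (real ^ 'd) set) \<Rightarrow> bool" where
  "continuous_subbundle M V \<longleftrightarrow>
     (\<exists>P :: circle ^ 'd \<Rightarrow> real ^ 'd ^ 'd.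
        continuous_on (torus_proj -` M) (P \<circ> torus_proj) \<and>
        (\<forall>p\<in>M. P p ** P p = P p \<and> range ((*v) (P p)) = V p))"

text \<open>Normal hyperbolicity of a compact \<open>C\<^sup>1\<close> submanifold \<open>M\<close> for the flow of \<open>H\<close>: \<open>M\<close> is
  invariant, the tangent bundle over \<open>M\<close> has a continuous splitting \<open>TM \<oplus> E\<^sup>s \<oplus> E\<^sup>u\<close> that is
  invariant under the linearised flow, and the contraction in \<open>E\<^sup>s\<close> and expansion in \<open>E\<^sup>u\<close>
  dominate the growth in the tangent directions.\<close>

definition normally_hyperbolic ::
    "(circle ^ 'd \<Rightarrow> real ^ 'd) \<Rightarrow> (circle ^ 'd) set \<Rightarrow> bool" where
  "normally_hyperbolic H M \<longleftrightarrow>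
     (\<forall>t x. torus_proj x \<in> M \<longrightarrow> torus_proj (flow_lift H t x) \<in> M) \<and>
     (\<exists>Es Eu C a b.
        continuous_subbundle M Es \<and> continuous_subbundle M Eu \<and>
        (\<forall>p\<in>M. \<forall>v. \<exists>!w. w \<in> tangent_space M p \<times> Es p \<times> Eu p \<and>
           v = fst w + fst (snd w) + snd (snd w)) \<and>
        (\<forall>t x. torus_proj x \<in> M \<longrightarrow>
           flow_deriv H t x ` Es (torus_proj x) = Es (torus_proj (flow_lift H t x)) \<and>
           flow_deriv H t x ` Eu (torus_proj x) = Eu (torus_proj (flow_lift H t x))) \<and>
        0 < C \<and> 0 \<le> a \<and> a < b \<and>
        (\<forall>t x v. torus_proj x \<in> M \<longrightarrow>
           (v \<in> tangent_space M (torus_proj x) \<longrightarrow>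
              norm (flow_deriv H t x v) \<le> C * exp (a * \<bar>t\<bar>) * norm v) \<and>
           (v \<in> Es (torus_proj x) \<and> 0 \<le> t \<longrightarrow>
              norm (flow_deriv H t x v) \<le> C * exp (- b * t) * norm v) \<and>
           (v \<in> Eu (torus_proj x) \<and> t \<le> 0 \<longrightarrow>
              norm (flow_deriv H t x v) \<le> C * exp (b * t) * norm v)))"

end

theory Submission imports Defs begin

text \<open>By equivariance \<open>H\<close> is constant along the group orbits, so \<open>DH\<close> annihilates the image of \<open>R\<close>,
  while \<open>DH \<circ> E\<close> acts on the image of \<open>N\<close> as \<open>L\<close>. The two equations therefore have the same
  left-hand side at every point.\<close>

text \<open>\<open>torus_deriv\<close> is read off at one chosen representative, but
  \<open>torus_deriv_proj\<close> allows any. The \<open>C1_on_torus\<close> hypothesis thus becomes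
  a derivative fact at every point of the universal cover, ready for the chain rule.\<close>

lemma C1_on_torus_has_derivative:
  assumes "C1_on_torus f"
  shows "((f \<circ> torus_proj) has_derivative torus_deriv f (torus_proj x)) (at x)"
proof -
  obtain f' where "((f \<circ> torus_proj) has_derivative blinfun_apply (f' x)) (at x)"
    using assms unfolding C1_on_torus_def by blast
  then show ?thesis
    using torus_deriv_proj by metis
qed

lemma linear_torus_deriv:
  assumes "C1_on_torus f"
  shows "linear (torus_deriv f p)"
  using C1_on_torus_has_derivative[OF assms, of "torus_rep p"]
  by (simp add: has_derivative_linear)

text \<open>Bounded linear maps commute with differentiation on the universal cover. With
  \<open>R\<close> and \<open>N\<close> for \<open>A\<close> and \<open>B\<close>, this
  differentiates \<open>e1\<close>.\<close>

lemma torus_deriv_linear_comp_add: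
  fixes A :: "real ^ 'a \<Rightarrow> real ^ 'c" and B :: "real ^ 'b \<Rightarrow> real ^ 'c"
  assumes "linear A" "linear B" "C1_on_torus f" "C1_on_torus g"
  shows "torus_deriv (\<lambda>p. A (f p) + B (g p)) p v = A (torus_deriv f p v) + B (torus_deriv g p v)"
proof -
  let ?x = "torus_rep p"
  have f: "((\<lambda>x. f (torus_proj x)) has_derivative torus_deriv f p) (at ?x)"
    and g: "((\<lambda>x. g (torus_proj x)) has_derivative torus_deriv g p) (at ?x)"
    using C1_on_torus_has_derivative[OF assms(3), of ?x]
      C1_on_torus_has_derivative[OF assms(4), of ?x] by (simp_all add: o_def)
  have A: "bounded_linear A" and B: "bounded_linear B"
    using assms by (simp_all add: linear_linear)
  have "((\<lambda>x. A (f (torus_proj x)) + B (g (torus_proj x))) has_derivative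
      (\<lambda>v. A (torus_deriv f p v) + B (torus_deriv g p v))) (at ?x)"
    by (rule has_derivative_add[OF bounded_linear.has_derivative[OF A f]
          bounded_linear.has_derivative[OF B g]])
  then have "(((\<lambda>p. A (f p) + B (g p)) \<circ> torus_proj) has_derivative
      (\<lambda>v. A (torus_deriv f p v) + B (torus_deriv g p v))) (at ?x)"
    by (simp add: o_def)
  from torus_deriv_proj[OF this] show ?thesis by simp
qed

text \<open>The lift of \<open>H\<close> is constant along the line through
  \<open>torus_rep p\<close> in direction \<open>R v\<close>, since this line projects into a single
  group orbit. Its derivative in that direction is therefore zero.\<close>

lemma torus_deriv_equivariant:
  fixes R :: "real ^ 'm \<Rightarrow> real ^ 'd" and H :: "circle ^ 'd \<Rightarrow> real ^ 'k"
  assumes "linear R" and "\<And>i j. matrix R $ i $ j \<in> \<int>" and "C1_on_torus H"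
    and equiv: "\<And>\<theta> \<phi>. H (\<theta> + torus_map R \<phi>) = H \<theta>"
  shows "torus_deriv H p (R v) = 0"
proof -
  let ?x = "torus_rep p"
  \<comment> \<open>The base point is written as the value at time 0 of the curve below, the form
    that \<open>diff_chain_at\<close> expects.\<close>
  have "((H \<circ> torus_proj) has_derivative torus_deriv H p) (at (?x + R (0 *\<^sub>R v)))"
    using C1_on_torus_has_derivative[OF assms(3), of ?x] \<open>linear R\<close> by (simp add: linear_0)
  moreover have "((\<lambda>t. ?x + R (t *\<^sub>R v)) has_derivative (\<lambda>t. R (t *\<^sub>R v))) (at 0)"
    using \<open>linear R\<close>
    by (auto intro!: derivative_eq_intros bounded_linear.has_derivative[of R] simp: linear_linear)
  ultimately have "((H \<circ> torus_proj) \<circ> (\<lambda>t. ?x + R (t *\<^sub>R v)) has_derivative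
      torus_deriv H p \<circ> (\<lambda>t. R (t *\<^sub>R v))) (at (0::real))"
    by (intro diff_chain_at)
  \<comment> \<open>Integrality of the matrix enters here: \<open>torus_map_proj\<close>, read from
    right to left, turns the projection of \<open>R (t *\<^sub>R v)\<close> into
    \<open>torus_map R\<close> of a torus point, a translation that \<open>equiv\<close>
    removes.\<close>
  moreover have "(H \<circ> torus_proj) \<circ> (\<lambda>t. ?x + R (t *\<^sub>R v)) = (\<lambda>t. H p)"
    using equiv by (auto simp: torus_proj_add simp flip: torus_map_proj[OF assms(1,2)])
  ultimately have "((\<lambda>t. H p) has_derivative torus_deriv H p \<circ> (\<lambda>t. R (t *\<^sub>R v))) (at (0::real))"
    by simp
  then have "torus_deriv H p \<circ> (\<lambda>t. R (t *\<^sub>R v)) = (\<lambda>t::real. 0)"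
    using has_derivative_const by (rule has_derivative_unique)
  \<comment> \<open>The two derivatives agree as functions of the time increment; the increment 1
    recovers \<open>R v\<close>.\<close>
  from fun_cong[OF this, of 1] show ?thesis by simp
qed

theorem proposition2p5:
  fixes R :: "real ^ 'm \<Rightarrow> real ^ 'd"
    and H Z :: "circle ^ 'd \<Rightarrow> real ^ 'd"
    and \<theta>0 :: "circle ^ 'd"
    and \<Omega> :: "real ^ 'm"
    and E :: "circle ^ 'm \<Rightarrow> circle ^ 'd"
    and N :: "real ^ 'k \<Rightarrow> real ^ 'd"
    and L :: "real ^ 'k \<Rightarrow> real ^ 'k"
    and G1 e1 :: "circle ^ 'm \<Rightarrow> real ^ 'd"
    and X1 f1 :: "circle ^ 'm \<Rightarrow> real ^ 'm"
    and Y1 :: "circle ^ 'm \<Rightarrow> real ^ 'k"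
  assumes dim: "CARD('k) = CARD('d) - CARD('m)"
    and R_linear: "linear R"
    and R_integer: "\<And>i j. matrix R $ i $ j \<in> \<int>"
    and R_free: "\<And>\<theta> \<phi>. \<theta> + torus_map R \<phi> = \<theta> \<Longrightarrow> \<phi> = 0"
    and H_C1: "C1_on_torus H"
    and H_equivariant: "\<And>\<theta> \<phi>. H (\<theta> + torus_map R \<phi>) = H \<theta>"
    and rel_equilibrium: "H \<theta>0 = R \<Omega>"
    and E_def: "E = (\<lambda>\<phi>. \<theta>0 + torus_map R \<phi>)"
    and E_normally_hyperbolic: "normally_hyperbolic H (range E)"
    and N_linear: "linear N"
    and N_inj: "inj N"
    and L_linear: "linear L"
    and L_hyperbolic: "hyperbolic L"
    and sum_RN: "{u + v |u v. u \<in> range R \<and> v \<in> range N} = UNIV"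
    and direct_RN: "range R \<inter> range N = {0}"
    and DH_N: "\<And>\<phi> y. torus_deriv H (E \<phi>) (N y) = N (L y)"
    and G1_def: "G1 = Z \<circ> E"
    and X1_C1: "C1_on_torus X1"
    and Y1_C1: "C1_on_torus Y1"
    and e1_def: "e1 = (\<lambda>\<phi>. R (X1 \<phi>) + N (Y1 \<phi>))"
  shows "(\<forall>\<phi>. dir_deriv \<Omega> e1 \<phi> - torus_deriv H (E \<phi>) (e1 \<phi>) + R (f1 \<phi>) = G1 \<phi>) \<longleftrightarrow>
         (\<forall>\<phi>. R (dir_deriv \<Omega> X1 \<phi> + f1 \<phi>) + N (dir_deriv \<Omega> Y1 \<phi> - L (Y1 \<phi>)) = G1 \<phi>)"
proof -
  have "dir_deriv \<Omega> e1 \<phi> - torus_deriv H (E \<phi>) (e1 \<phi>) + R (f1 \<phi>) =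
      R (dir_deriv \<Omega> X1 \<phi> + f1 \<phi>) + N (dir_deriv \<Omega> Y1 \<phi> - L (Y1 \<phi>))" for \<phi>
  proof -
    \<comment> \<open>Linearity of the derivative splits \<open>e1\<close> into its \<open>R\<close>
      part, tangent to the orbit and hence annihilated, and its \<open>N\<close> part, rewritten by
      \<open>DH_N\<close>.\<close>
    have "torus_deriv H (E \<phi>) (e1 \<phi>) = N (L (Y1 \<phi>))"
      using torus_deriv_equivariant[of R H, OF R_linear R_integer H_C1 H_equivariant]
      by (simp add: e1_def linear_add[OF linear_torus_deriv[OF H_C1]] DH_N)
    then show ?thesis
      by (simp add: dir_deriv_def e1_def linear_add[OF R_linear] linear_diff[OF N_linear]
          torus_deriv_linear_comp_add[OF R_linear N_linear X1_C1 Y1_C1])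
  qed
  then show ?thesis by simp
qed

end
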